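(* Let $D=\omega^{<\omega}$ and $\mathcal A=\{B_f:f\in\omega^\omega\}$, where $B_f=\{f\restriction n:n\in\omega\}$. Then $\mathsf S_1(\mathcal I(\mathcal A)^+,\mathcal I(\mathcal A)^+)$ holds and Player I has a winning strategy in $\mathsf G_1(\mathcal I(\mathcal A)^+,\mathcal I(\mathcal A)^+)$. Consequently, $L_{\mathcal A}$ satisfies $\mathsf S_1(\mathsf V_1,\mathsf V_1)$ at its greatest element $1=D$, but Player I has a winning strategy in $\mathsf G_1(\mathsf V_1,\mathsf V_1)$ on $L_{\mathcal A}$.
   Context: Let $D$ be a countably infinite set. A family $\mathcal A\subseteq[D]^\omega$ of infinite subsets of $D$ is almost disjoint if distinct members have finite intersection. For an infinite almost disjoint family $\mathcal A$ on $D$, put $$\mathcal I(\mathcal A)=\{S\subseteq D:S\subseteq^*\textstyle\bigcup\mathcal F\text{ for some finite }\mathcal F\subseteq\mathcal A\},$$ where $S\subseteq^*T$ means that $S\setminus T$ is finite; let $\mathcal I(\mathcal A)^+=\mathcal P(D)\setminus\mathcal I(\mathcal A)$. Let $\mathcal C(\mathcal A)=\{F\cup\bigcup\mathcal F:F\subseteq D\text{ finite},\ \mathcal F\subseteq\mathcal A\text{ finite}\}$ and $L_{\mathcal A}=\mathcal C(\mathcal A)\cup\{D\}$, ordered by inclusion. It is a complete bounded distributive lattice with greatest element $D$. For a poset with greatest element $1$, $\mathsf V_1$ denotes the family of all nonempty subsets whose supremum is $1$. For a nonempty family $\mathcal B$ of nonempty subsets of a set $E$: $\mathsf S_1(\mathcal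 B,\mathcal B)$ asserts that for every sequence $(A_n)_{n\in\omega}$ in $\mathcal B$ there are $a_n\in A_n$ with $\{a_n:n\in\omega\}\in\mathcal B$. In the game $\mathsf G_1(\mathcal B,\mathcal B)$, in each inning $n\in\omega$ Player I chooses $A_n\in\mathcal B$ and then Player II chooses $a_n\in A_n$; Player II wins if $\{a_n:n\in\omega\}\in\mathcal B$, otherwise Player I wins. A strategy is a function telling a player how to play based on the previous moves of the opponent. *)

theory Defs
  imports Complex_Main "HOL-Library.Lub_Glb"
begin

section \<open>Almost disjoint families\<close>

definition almost_disjoint_family :: "'a set \<Rightarrow> 'a set set \<Rightarrow> bool" where
  "almost_disjoint_family D A \<longleftrightarrow>
     (\<forall>S\<in>A. S \<subseteq> D \<and> infinite S) \<and>
     (\<forall>S\<in>A. \<forall>T\<in>A. S \<noteq> T \<longrightarrow> finite (S \<inter> T))"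

definition almost_subset :: "'a set \<Rightarrow> 'a set \<Rightarrow> bool"  (infix \<open>\<subseteq>*\<close> 50) where
  "S \<subseteq>* T \<longleftrightarrow> finite (S - T)"

definition ad_ideal :: "'a set \<Rightarrow> 'a set set \<Rightarrow> 'a set set" where
  "ad_ideal D A = {S. S \<subseteq> D \<and> (\<exists>F. finite F \<and> F \<subseteq> A \<and> S \<subseteq>* \<Union>F)}"

definition ad_positive :: "'a set \<Rightarrow> 'a set set \<Rightarrow> 'a set set" where
  "ad_positive D A = Pow D - ad_ideal D A"

definition ad_closed :: "'a set \<Rightarrow> 'a set set \<Rightarrow> 'a set set" where
  "ad_closed D A = {G \<union> \<Union>F | G F. finite G \<and> G \<subseteq> D \<and> finite F \<and> F \<subseteq> A}"

definition ad_lattice :: "'a set \<Rightarrow> 'a set set \<Rightarrow> 'a set set" where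
  "ad_lattice D A = ad_closed D A \<union> {D}"

section \<open>Nonempty sets with supremum one\<close>

text \<open>The poset is the carrier \<open>L\<close> with the order of its type, and the argument \<open>one\<close> is meant
  to be the greatest element of \<open>L\<close>. Note that \<open>isLub L X one\<close> is the supremum relative to \<open>L\<close>:
  only upper bounds in \<open>L\<close> count. For a lattice of sets it is in general weaker than
  \<open>\<Union>X = one\<close>.\<close>

definition sup_one :: "'a::ord set \<Rightarrow> 'a \<Rightarrow> 'a set set" where
  "sup_one L one = {X. X \<subseteq> L \<and> X \<noteq> {} \<and> isLub L X one}"

section \<open>Selection principle and game\<close>

definition S1 :: "'b set set \<Rightarrow> 'b set set \<Rightarrow> bool" where
  "S1 B C \<longleftrightarrow>
     (\<forall>A :: nat \<Rightarrow> 'b set. (\<forall>n. A n \<in> B) \<longrightarrow>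
        (\<exists>a. (\<forall>n. a n \<in> A n) \<and> range a \<in> C))"

text \<open>A strategy of Player I maps the finite list of the previous moves of Player II, oldest
  first, to the next move of Player I. Only its values at lists that arise in a play following
  the strategy are constrained.\<close>

definition legal_moves_II :: "('b list \<Rightarrow> 'b set) \<Rightarrow> 'b list \<Rightarrow> bool" where
  "legal_moves_II \<sigma> s \<longleftrightarrow> (\<forall>i<length s. s ! i \<in> \<sigma> (take i s))"

definition G1_strategy_I :: "'b set set \<Rightarrow> ('b list \<Rightarrow> 'b set) \<Rightarrow> bool" where
  "G1_strategy_I B \<sigma> \<longleftrightarrow> (\<forall>s. legal_moves_II \<sigma> s \<longrightarrow> \<sigma> s \<in> B)"

definition G1_I_has_winning_strategy :: "'b set set \<Rightarrow> 'b set set \<Rightarrow> bool" where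
  "G1_I_has_winning_strategy B C \<longleftrightarrow>
     (\<exists>\<sigma>. G1_strategy_I B \<sigma> \<and>
        (\<forall>a :: nat \<Rightarrow> 'b. (\<forall>n. a n \<in> \<sigma> (map a [0..<n])) \<longrightarrow> range a \<notin> C))"

section \<open>The branches of the tree of finite sequences of natural numbers\<close>

text \<open>The set of all finite sequences of natural numbers is \<open>UNIV :: nat list set\<close>;
  \<open>map f [0..<n]\<close> is the restriction of \<open>f\<close> to \<open>n\<close>.\<close>

definition branch :: "(nat \<Rightarrow> nat) \<Rightarrow> nat list set" where
  "branch f = {map f [0..<n] | n. True}"

definition branches :: "nat list set set" where
  "branches = range branch"

text \<open>The standing assumptions on the family hold, and the whole set is the greatest element of
  the lattice.\<close>

lemma infinite_branch: "infinite (branch f)"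
proof -
  have "inj (\<lambda>n. map f [0..<n])"
    by (rule injI) (drule arg_cong[where f = length], simp)
  moreover have "branch f = range (\<lambda>n. map f [0..<n])"
    by (auto simp: branch_def)
  ultimately show ?thesis
    by (simp add: finite_image_iff)
qed

lemma finite_branch_Int:
  assumes "f k \<noteq> g k"
  shows "finite (branch f \<inter> branch g)"
proof -
  have "branch f \<inter> branch g \<subseteq> (\<lambda>n. map f [0..<n]) ` {..k}"
  proof
    fix s assume "s \<in> branch f \<inter> branch g"
    then obtain n m where s: "s = map f [0..<n]" "s = map g [0..<m]"
      unfolding branch_def by blast
    then have "length (map f [0..<n]) = length (map g [0..<m])"
      by simp
    then have "n = m"
      by simp
    with s have "map f [0..<n] = map g [0..<n]"
      by simp
    then have "\<forall>i<n. f i = g i"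
      by simp
    with assms have "n \<le> k"
      by (meson not_le)
    with s show "s \<in> (\<lambda>n. map f [0..<n]) ` {..k}"
      by auto
  qed
  then show ?thesis
    by (rule finite_subset) simp
qed

lemma almost_disjoint_branches: "almost_disjoint_family UNIV branches"
proof -
  have "finite (branch f \<inter> branch g)" if "branch f \<noteq> branch g" for f g
  proof -
    from that have "f \<noteq> g"
      by blast
    then obtain k where "f k \<noteq> g k"
      by blast
    then show ?thesis
      by (rule finite_branch_Int)
  qed
  then show ?thesis
    by (auto simp: almost_disjoint_family_def branches_def infinite_branch)
qed

lemma infinite_branches: "infinite branches"
proof -
  have "inj (\<lambda>i::nat. branch (\<lambda>_. i))"
  proof (rule injI, rule ccontr)
    fix i j :: nat
    assume eq: "branch (\<lambda>_. i) = branch (\<lambda>_. j)" and "i \<noteq> j"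
    then have "finite (branch (\<lambda>_. i) \<inter> branch (\<lambda>_. j))"
      by (intro finite_branch_Int)
    with eq show False
      by (simp add: infinite_branch)
  qed
  then have "infinite (range (\<lambda>i::nat. branch (\<lambda>_. i)))"
    by (simp add: finite_image_iff)
  moreover have "range (\<lambda>i::nat. branch (\<lambda>_. i)) \<subseteq> branches"
    by (auto simp: branches_def)
  ultimately show ?thesis
    using finite_subset by blast
qed

lemma greatest_ad_lattice:
  assumes "almost_disjoint_family D A"
  shows "D \<in> ad_lattice D A" and "\<And>C. C \<in> ad_lattice D A \<Longrightarrow> C \<subseteq> D"
  using assms by (auto simp: ad_lattice_def ad_closed_def almost_disjoint_family_def)

end

theory Submission
  imports Defs "HOL-Library.Infinite_Set" "HOL-Library.Nat_Bijection"
begin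

text \<open>
  The selection principle holds for every almost disjoint family \<open>A\<close>. A positive set stays
  infinite after finitely many members of \<open>A\<close> are removed. Suppose that no selection from the
  positive sets \<open>X n\<close> has positive range. Then one finds, recursively, injective selections \<open>g j\<close>
  and finite sets \<open>F 0 \<subseteq> F 1 \<subseteq> \<dots>\<close> of members of \<open>A\<close> such that \<open>g j\<close> avoids \<open>\<Union>(F j)\<close>, while its
  range is almost covered by \<open>\<Union>(F (j + 1))\<close>. Split the innings into infinitely many infinite
  blocks and play \<open>g j\<close> on the \<open>j\<close>-th block. If the resulting selection were almost covered by a
  finite \<open>G \<subseteq> A\<close>, each block would meet some \<open>B \<in> G\<close> in an infinite set; almost disjointness
  forces \<open>B \<in> F (j + 1)\<close>, so later blocks avoid \<open>B\<close>, and different blocks need different members of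
  the finite set \<open>G\<close>.

  In the game for the branches of the tree, Player I always plays the immediate successors of the
  last move of Player II. This is an infinite set that meets each branch in at most one point, so it
  is positive; but the moves of Player II run along a single branch.

  Both results pass to the lattice because a set \<open>X\<close> of its elements has supremum \<open>D\<close> iff
  \<open>\<Union>X\<close> is positive: the lattice elements other than \<open>D\<close> are cofinal in the ideal. Points are
  replaced by lattice elements containing them for the selection principle, and by singletons for
  the game.
\<close>

section \<open>Positive sets of an almost disjoint family\<close>

lemma almost_subset_mono: "\<lbrakk>T \<subseteq>* U; S \<subseteq> T; U \<subseteq> V\<rbrakk> \<Longrightarrow> S \<subseteq>* V"
  unfolding almost_subset_def by (meson Diff_mono finite_subset)

lemma ad_positive_mono:
  assumes "S \<in> ad_positive D A" "S \<subseteq> T" "T \<subseteq> D"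
  shows "T \<in> ad_positive D A"
proof -
  have "S \<in> ad_ideal D A" if "T \<in> ad_ideal D A"
    using that assms(2,3) almost_subset_mono[OF _ assms(2) order_refl]
    unfolding ad_ideal_def by blast
  with assms show ?thesis
    unfolding ad_positive_def by blast
qed

lemma infinite_ad_positive_Diff:
  assumes "S \<in> ad_positive D A" "finite F" "F \<subseteq> A"
  shows "infinite (S - \<Union>F)"
  using assms unfolding ad_positive_def ad_ideal_def almost_subset_def by blast

lemma almost_subset_Union_infinite_Int:
  assumes "infinite S" "finite F" "S \<subseteq>* \<Union>F"
  obtains B where "B \<in> F" "infinite (S \<inter> B)"
proof -
  have "S = (S - \<Union>F) \<union> (\<Union>B\<in>F. S \<inter> B)"
    by blast
  with assms have "infinite (\<Union>B\<in>F. S \<inter> B)"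
    unfolding almost_subset_def by (metis finite_UnI)
  with \<open>finite F\<close> that show thesis
    by blast
qed

lemma ad_positiveI_finite_Int:
  assumes "S \<subseteq> D" "infinite S" "\<And>B. B \<in> A \<Longrightarrow> finite (S \<inter> B)"
  shows "S \<in> ad_positive D A"
proof -
  have "\<not> S \<subseteq>* \<Union>F" if "finite F" "F \<subseteq> A" for F
    using almost_subset_Union_infinite_Int[OF assms(2) that(1)] assms(3) that(2) by blast
  with assms(1) show ?thesis
    unfolding ad_positive_def ad_ideal_def by blast
qed

section \<open>The selection principle for positive sets\<close>

lemma ex_inj_selection:
  fixes X :: "nat \<Rightarrow> 'a set"
  assumes "\<And>n. infinite (X n)"
  obtains g where "inj g" "\<And>n. g n \<in> X n"
proof -
  have "\<exists>g. \<forall>n. g n \<in> X n - g ` {..<n}"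
  proof (rule dependent_wellorder_choice)
    fix n :: nat and g :: "nat \<Rightarrow> 'a"
    have "infinite (X n - g ` {..<n})"
      using assms by simp
    then show "\<exists>r. r \<in> X n - g ` {..<n}"
      using infinite_imp_nonempty by blast
  next
    fix r :: 'a and g h :: "nat \<Rightarrow> 'a" and n :: nat
    assume "\<And>k. k < n \<Longrightarrow> g k = h k"
    then have "g ` {..<n} = h ` {..<n}"
      by (intro image_cong) auto
    then show "(r \<in> X n - g ` {..<n}) = (r \<in> X n - h ` {..<n})"
      by simp
  qed
  then obtain g where g: "\<And>n. g n \<in> X n - g ` {..<n}"
    by blast
  have "inj g"
  proof (rule linorder_injI)
    show "g i \<noteq> g j" if "i < j" for i j :: nat
      using g[of j] that by (metis DiffD2 imageI lessThan_iff)
  qed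
  with g that show thesis
    by blast
qed

theorem S1_ad_positive:
  assumes "almost_disjoint_family D A"
  shows "S1 (ad_positive D A) (ad_positive D A)"
  unfolding S1_def
proof (intro allI impI, rule ccontr)
  fix X :: "nat \<Rightarrow> 'a set"
  assume X: "\<forall>n. X n \<in> ad_positive D A"
    and no_sel: "\<nexists>a. (\<forall>n. a n \<in> X n) \<and> range a \<in> ad_positive D A"
  have sub: "X n \<subseteq> D" for n
    using X unfolding ad_positive_def by blast
  have cover: "\<exists>F. finite F \<and> F \<subseteq> A \<and> range a \<subseteq>* \<Union>F" if "\<And>n. a n \<in> X n" for a
  proof -
    have "range a \<subseteq> D"
      using that sub by blast
    moreover have "range a \<notin> ad_positive D A"
      using no_sel that by blast
    ultimately show ?thesis
      unfolding ad_positive_def ad_ideal_def by blast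
  qed
  have step: "\<exists>F' g. finite F' \<and> F' \<subseteq> A \<and> F \<subseteq> F' \<and> inj g \<and>
      (\<forall>n. g n \<in> X n - \<Union>F) \<and> range g \<subseteq>* \<Union>F'" if F: "finite F" "F \<subseteq> A" for F
  proof -
    obtain g where g: "inj g" "\<And>n. g n \<in> X n - \<Union>F"
      by (rule ex_inj_selection[of "\<lambda>n. X n - \<Union>F"]) (use X F infinite_ad_positive_Diff in blast)+
    then obtain H where H: "finite H" "H \<subseteq> A" "range g \<subseteq>* \<Union>H"
      using cover[of g] by blast
    then have "range g \<subseteq>* \<Union>(F \<union> H)"
      by (blast intro: almost_subset_mono)
    with F g H show ?thesis
      by (intro exI[of _ "F \<union> H"] exI[of _ g]) auto
  qed
  have "\<exists>F. \<forall>j. (finite (F j) \<and> F j \<subseteq> A) \<and>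
      (F j \<subseteq> F (Suc j) \<and>
       (\<exists>g. inj g \<and> (\<forall>n. g n \<in> X n - \<Union>(F j)) \<and> range g \<subseteq>* \<Union>(F (Suc j))))"
  proof (rule dependent_nat_choice)
    show "\<exists>F. finite F \<and> F \<subseteq> A"
      by blast
    show "\<exists>F'. (finite F' \<and> F' \<subseteq> A) \<and>
        (F \<subseteq> F' \<and> (\<exists>g. inj g \<and> (\<forall>n. g n \<in> X n - \<Union>F) \<and> range g \<subseteq>* \<Union>F'))"
      if "finite F \<and> F \<subseteq> A" for F
      using step[of F] that by metis
  qed
  then obtain F where F_all: "\<forall>j. (finite (F j) \<and> F j \<subseteq> A) \<and>
      (F j \<subseteq> F (Suc j) \<and>
       (\<exists>g. inj g \<and> (\<forall>n. g n \<in> X n - \<Union>(F j)) \<and> range g \<subseteq>* \<Union>(F (Suc j))))" ..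
  then have F: "finite (F j)" "F j \<subseteq> A" "F j \<subseteq> F (Suc j)" for j
    by simp_all
  from F_all have "\<forall>j. \<exists>g. inj g \<and> (\<forall>n. g n \<in> X n - \<Union>(F j)) \<and> range g \<subseteq>* \<Union>(F (Suc j))"
    by simp
  then obtain g where "\<forall>j. inj (g j) \<and> (\<forall>n. g j n \<in> X n - \<Union>(F j)) \<and>
      range (g j) \<subseteq>* \<Union>(F (Suc j))"
    unfolding choice_iff ..
  then have g: "inj (g j)" "g j n \<in> X n - \<Union>(F j)" "range (g j) \<subseteq>* \<Union>(F (Suc j))" for j n
    by simp_all
  \<comment> \<open>The pairing function splits the innings into the infinite blocks \<open>P j\<close>.\<close>
  define P :: "nat \<Rightarrow> nat set" where "P j = range (\<lambda>k. prod_encode (j, k))" for j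
  define a where "a n = g (fst (prod_decode n)) n" for n
  have a_block: "a n = g j n" if "n \<in> P j" for n j
    using that by (auto simp: a_def P_def)
  have "a n \<in> X n" for n
    using g(2) by (simp add: a_def)
  then obtain G where G: "finite G" "G \<subseteq> A" "range a \<subseteq>* \<Union>G"
    using cover by blast
  have "\<exists>B\<in>G. B \<in> F (Suc j) \<and> infinite (g j ` P j \<inter> B)" for j
  proof -
    have "infinite (P j)"
      unfolding P_def by (intro range_inj_infinite injI) simp
    then have "infinite (g j ` P j)"
      using g(1) inj_on_subset[OF _ subset_UNIV] finite_imageD by metis
    moreover have "g j ` P j \<subseteq> range a"
      using a_block[symmetric] by auto
    with G(3) have "g j ` P j \<subseteq>* \<Union>G"
      by (blast intro: almost_subset_mono)
    ultimately obtain B where B: "B \<in> G" "infinite (g j ` P j \<inter> B)"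
      using G(1) almost_subset_Union_infinite_Int by metis
    \<comment> \<open>The range of \<open>g j\<close> is almost covered by \<open>F (Suc j)\<close> too, so \<open>B\<close> has infinite
      intersection with a member of \<open>F (Suc j)\<close> and hence equals it.\<close>
    have "g j ` P j \<inter> B \<subseteq>* \<Union>(F (Suc j))"
      using g(3)[of j] by (rule almost_subset_mono) auto
    with B(2) F(1) obtain C where C: "C \<in> F (Suc j)" "infinite (g j ` P j \<inter> B \<inter> C)"
      using almost_subset_Union_infinite_Int by metis
    then have "infinite (B \<inter> C)"
      by (meson finite_subset inf_mono inf_le2 order_refl)
    with B(1) C(1) G(2) F(2) assms have "B = C"
      unfolding almost_disjoint_family_def by blast
    with B C show ?thesis
      by blast
  qed
  then obtain B where B: "\<And>j. B j \<in> G" "\<And>j. B j \<in> F (Suc j)" "\<And>j. infinite (g j ` P j \<inter> B j)"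
    by metis
  have "inj B"
  proof (rule linorder_injI)
    fix i j :: nat
    assume "i < j"
    then have "F (Suc i) \<subseteq> F j"
      using lift_Suc_mono_le[of F] F(3) by simp
    then have "g j ` P j \<inter> B i = {}"
      using B(2)[of i] g(2)[of j] by blast
    with B(3)[of j] show "B i \<noteq> B j"
      by auto
  qed
  moreover have "range B \<subseteq> G"
    using B(1) by blast
  ultimately show False
    using G(1) finite_subset range_inj_infinite by blast
qed

section \<open>Immediate successors in the tree\<close>

text \<open>The set of immediate successors of a node of the tree.\<close>

definition succs :: "nat list \<Rightarrow> nat list set" where
  "succs s = range (\<lambda>i. s @ [i])"

lemma succs_ad_positive: "succs s \<in> ad_positive UNIV branches"
proof (rule ad_positiveI_finite_Int)
  show "infinite (succs s)"
    unfolding succs_def by (intro range_inj_infinite injI) simp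
  fix B assume "B \<in> branches"
  then obtain f where "B = branch f"
    unfolding branches_def by blast
  have "t = map f [0..<Suc (length s)]" if "t \<in> succs s" "t \<in> B" for t
  proof -
    from that(2) obtain n where t: "t = map f [0..<n]"
      unfolding \<open>B = branch f\<close> branch_def by blast
    moreover have "length t = Suc (length s)"
      using that(1) by (auto simp: succs_def)
    ultimately show ?thesis
      by simp
  qed
  then have "succs s \<inter> B \<subseteq> {map f [0..<Suc (length s)]}"
    by blast
  then show "finite (succs s \<inter> B)"
    by (rule finite_subset) simp
qed simp

lemma UNIV_ad_positive: "UNIV \<in> ad_positive UNIV branches"
  by (rule ad_positive_mono[OF succs_ad_positive]) auto

lemma I_wins_ad_positive_branches:
  "G1_I_has_winning_strategy (ad_positive UNIV branches) (ad_positive UNIV branches)"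
  unfolding G1_I_has_winning_strategy_def
proof (intro exI conjI allI impI)
  \<comment> \<open>In the first inning, the successors of the root are played.\<close>
  let ?\<sigma> = "\<lambda>s. succs (if s = [] then [] else last s)"
  show "G1_strategy_I (ad_positive UNIV branches) ?\<sigma>"
    unfolding G1_strategy_I_def using succs_ad_positive by blast
  fix a :: "nat \<Rightarrow> nat list"
  assume "\<forall>n. a n \<in> ?\<sigma> (map a [0..<n])"
  then have play: "a n \<in> ?\<sigma> (map a [0..<n])" for n
    by blast
  define f where "f n = last (a n)" for n
  have "a n = map f [0..<Suc n]" for n
  proof (induction n)
    case 0
    then show ?case
      using play[of 0] by (auto simp: succs_def f_def)
  next
    case (Suc n)
    have "a (Suc n) \<in> succs (a n)"
      using play[of "Suc n"] by simp
    then have "a (Suc n) = a n @ [f (Suc n)]"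
      by (auto simp: succs_def f_def)
    with Suc show ?case
      by simp
  qed
  then have "range a \<subseteq> branch f"
    unfolding branch_def by blast
  then have "range a \<subseteq>* \<Union>{branch f}"
    unfolding almost_subset_def by (simp add: Diff_eq_empty_iff[THEN iffD2])
  moreover have "{branch f} \<subseteq> branches"
    unfolding branches_def by blast
  ultimately show "range a \<notin> ad_positive UNIV branches"
    unfolding ad_positive_def ad_ideal_def by blast
qed

section \<open>Transfer to the lattice\<close>

text \<open>By this equivalence, an upper bound in the lattice other than \<open>D\<close> exists exactly for the families whose
  union lies in the ideal, provided that \<open>D\<close> itself is positive.\<close>

lemma ad_ideal_iff_subset_ad_closed:
  assumes "S \<subseteq> D"
  shows "S \<in> ad_ideal D A \<longleftrightarrow> (\<exists>C\<in>ad_closed D A. S \<subseteq> C)"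
proof
  assume "S \<in> ad_ideal D A"
  then obtain F where "finite F" "F \<subseteq> A" "finite (S - \<Union>F)"
    unfolding ad_ideal_def almost_subset_def by blast
  with assms have "(S - \<Union>F) \<union> \<Union>F \<in> ad_closed D A"
    unfolding ad_closed_def by blast
  then show "\<exists>C\<in>ad_closed D A. S \<subseteq> C"
    by (rule rev_bexI) blast
next
  assume "\<exists>C\<in>ad_closed D A. S \<subseteq> C"
  then obtain H F where HF: "finite H" "finite F" "F \<subseteq> A" "S \<subseteq> H \<union> \<Union>F"
    unfolding ad_closed_def by blast
  then have "S - \<Union>F \<subseteq> H"
    by blast
  with HF assms show "S \<in> ad_ideal D A"
    unfolding ad_ideal_def almost_subset_def by (blast intro: finite_subset)
qed

text \<open>Positivity of \<open>D\<close> says that \<open>D\<close> is not already one of the sets in \<open>ad_closed D A\<close>; it holds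
  for every infinite almost disjoint family.\<close>

lemma sup_one_ad_lattice_iff:
  assumes "almost_disjoint_family D A" and "D \<in> ad_positive D A"
  shows "X \<in> sup_one (ad_lattice D A) D \<longleftrightarrow>
    X \<subseteq> ad_lattice D A \<and> \<Union>X \<in> ad_positive D A"
proof (cases "X \<subseteq> ad_lattice D A")
  case True
  note L = greatest_ad_lattice[OF assms(1)]
  have le: "\<Union>X \<subseteq> D"
    using True L(2) by blast
  have not_D: "\<not> D \<subseteq> C" if "C \<in> ad_closed D A" for C
    using that assms(2) ad_ideal_iff_subset_ad_closed[of D D A] unfolding ad_positive_def by blast
  have "isLub (ad_lattice D A) X D \<longleftrightarrow> (\<forall>C\<in>ad_lattice D A. \<Union>X \<subseteq> C \<longrightarrow> D \<subseteq> C)"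
    using le L(1) unfolding isLub_def leastP_def isUb_def setle_def setge_def by blast
  also have "\<dots> \<longleftrightarrow> (\<forall>C\<in>ad_closed D A. \<not> \<Union>X \<subseteq> C)"
    using not_D unfolding ad_lattice_def by blast
  also have "\<dots> \<longleftrightarrow> \<Union>X \<in> ad_positive D A"
    using le ad_ideal_iff_subset_ad_closed[of "\<Union>X" D A] unfolding ad_positive_def by blast
  finally have iff: "isLub (ad_lattice D A) X D \<longleftrightarrow> \<Union>X \<in> ad_positive D A" .
  have "{} \<notin> ad_positive D A"
    unfolding ad_positive_def ad_ideal_def almost_subset_def by auto
  then have "X \<noteq> {}" if "\<Union>X \<in> ad_positive D A"
    using that by auto
  with iff True show ?thesis
    unfolding sup_one_def by blast
qed (simp add: sup_one_def)

lemma S1_sup_one_ad_lattice: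
  assumes "almost_disjoint_family D A" and "D \<in> ad_positive D A"
  shows "S1 (sup_one (ad_lattice D A) D) (sup_one (ad_lattice D A) D)"
  unfolding S1_def
proof (intro allI impI)
  fix X :: "nat \<Rightarrow> 'a set set"
  assume "\<forall>n. X n \<in> sup_one (ad_lattice D A) D"
  then have X: "\<And>n. X n \<subseteq> ad_lattice D A" "\<And>n. \<Union>(X n) \<in> ad_positive D A"
    using sup_one_ad_lattice_iff[OF assms] by blast+
  then obtain d where d: "\<And>n. d n \<in> \<Union>(X n)" "range d \<in> ad_positive D A"
    using S1_ad_positive[OF assms(1), unfolded S1_def, rule_format, of "\<lambda>n. \<Union>(X n)"] by blast
  have "\<forall>n. \<exists>S. S \<in> X n \<and> d n \<in> S"
    using d(1) by blast
  then obtain a where a: "\<And>n. a n \<in> X n" "\<And>n. d n \<in> a n"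
    by metis
  have L: "range a \<subseteq> ad_lattice D A"
    using a(1) X(1) by blast
  have "\<Union>(range a) \<in> ad_positive D A"
  proof (rule ad_positive_mono[OF d(2)])
    show "range d \<subseteq> \<Union>(range a)"
      using a(2) by blast
    show "\<Union>(range a) \<subseteq> D"
      using L greatest_ad_lattice(2)[OF assms(1)] by blast
  qed
  with L a(1) sup_one_ad_lattice_iff[OF assms]
  show "\<exists>a. (\<forall>n. a n \<in> X n) \<and> range a \<in> sup_one (ad_lattice D A) D"
    by blast
qed

lemma I_wins_sup_one_ad_lattice:
  assumes "almost_disjoint_family D A" and "D \<in> ad_positive D A"
    and "G1_I_has_winning_strategy (ad_positive D A) (ad_positive D A)"
  shows "G1_I_has_winning_strategy (sup_one (ad_lattice D A) D) (sup_one (ad_lattice D A) D)"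
proof -
  from assms(3) obtain \<sigma> where strat: "G1_strategy_I (ad_positive D A) \<sigma>"
    and win: "\<And>a. (\<forall>n. a n \<in> \<sigma> (map a [0..<n])) \<Longrightarrow> range a \<notin> ad_positive D A"
    unfolding G1_I_has_winning_strategy_def by blast
  define \<tau> where "\<tau> s = (\<lambda>x. {x}) ` \<sigma> (map the_elem s)" for s
  have the_elem_\<tau>: "the_elem S \<in> \<sigma> (map the_elem s)" "S = {the_elem S}" if "S \<in> \<tau> s" for S s
    using that by (auto simp: \<tau>_def)
  have "G1_strategy_I (sup_one (ad_lattice D A) D) \<tau>"
    unfolding G1_strategy_I_def
  proof (intro allI impI)
    fix s assume "legal_moves_II \<tau> s"
    then have "legal_moves_II \<sigma> (map the_elem s)"
      unfolding legal_moves_II_def by (auto simp: take_map dest!: the_elem_\<tau>(1))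
    then have pos: "\<sigma> (map the_elem s) \<in> ad_positive D A"
      using strat unfolding G1_strategy_I_def by blast
    have "{x} \<in> ad_lattice D A" if "x \<in> D" for x
    proof -
      have "{x} = {x} \<union> \<Union>{}"
        by simp
      with that show ?thesis
        unfolding ad_lattice_def ad_closed_def by blast
    qed
    with pos have "\<tau> s \<subseteq> ad_lattice D A"
      unfolding \<tau>_def ad_positive_def by blast
    moreover have "\<Union>(\<tau> s) = \<sigma> (map the_elem s)"
      unfolding \<tau>_def by blast
    ultimately show "\<tau> s \<in> sup_one (ad_lattice D A) D"
      using pos sup_one_ad_lattice_iff[OF assms(1,2)] by simp
  qed
  moreover have "range a \<notin> sup_one (ad_lattice D A) D" if "\<forall>n. a n \<in> \<tau> (map a [0..<n])" for a
  proof -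
    define d where "d = the_elem \<circ> a"
    have "d n \<in> \<sigma> (map d [0..<n])" for n
      using the_elem_\<tau>(1)[OF that[rule_format, of n]] by (simp add: d_def)
    then have "range d \<notin> ad_positive D A"
      using win by blast
    moreover have "a n = {d n}" for n
      using the_elem_\<tau>(2)[OF that[rule_format, of n]] by (simp add: d_def)
    then have "\<Union>(range a) = range d"
      by auto
    ultimately show ?thesis
      using sup_one_ad_lattice_iff[OF assms(1,2)] by simp
  qed
  ultimately show ?thesis
    unfolding G1_I_has_winning_strategy_def by blast
qed

section \<open>The tree of finite sequences\<close>

theorem proposition6p3:
  fixes D :: "nat list set" and A :: "nat list set set"
  assumes "D = UNIV" and "A = branches"
  shows "S1 (ad_positive D A) (ad_positive D A) \<and>
    G1_I_has_winning_strategy (ad_positive D A) (ad_positive D A) \<and>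
    S1 (sup_one (ad_lattice D A) D) (sup_one (ad_lattice D A) D) \<and>
    G1_I_has_winning_strategy (sup_one (ad_lattice D A) D) (sup_one (ad_lattice D A) D)"
  unfolding assms
  by (intro conjI S1_ad_positive S1_sup_one_ad_lattice I_wins_sup_one_ad_lattice
      almost_disjoint_branches UNIV_ad_positive I_wins_ad_positive_branches)

end
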